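(* For every $w\in S_n$, the Euler characteristic $\chi(w)$ of $w$ in the middle order lattice $\mathcal{P}_n$ equals the number of right-to-left non-minima of $w$. Moreover, for each $k$, the number of permutations of size $n$ with Euler characteristic $k$ is $c(n,n-k)$, the number of permutations of size $n$ having exactly $n-k$ cycles.
   Context: For $w\in S_n$ (one-line notation), its inversion sequence is $I(w)=(x_1,\ldots,x_n)$ with $x_i=\#\{j<i : w^{-1}(j)>w^{-1}(i)\}$. The middle order $\mathcal{P}_n$ is the poset on $S_n$ with $v\le w$ iff $I(v)\le I(w)$ coordinate-wise; it is a finite distributive lattice with minimum $\hat0$ the identity permutation. A valuation of a finite distributive lattice $L$ (with values in a commutative ring with identity) is a map $\nu$ with $\nu(\hat0)=0$ and $\nu(x)+\nu(y)=\nu(x\wedge y)+\nu(x\vee y)$ for all $x,y$; a valuation is uniquely determined by its (arbitrary) values on the join-irreducible elements (elements $a\ne\hat0$ such that $a=b\vee c$ implies $a\in\{b,c\}$). The Euler characteristic $\chi$ of $L$ is the unique valuation with $\chi(a)=1$ for every join-irreducible $a$. A right-to-left minimum of $w$ is a value $i$ such that no value smaller than $i$ appears to the right of $i$ in $w$; the other entries are right-to-left non-minima. *)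

theory Defs
  imports "HOL-Algebra.Lattice" "HOL-Library.FuncSet"
    "HOL-Combinatorics.Permutations" "HOL-Combinatorics.Orbits"
begin

section \<open>Valuations and Euler characteristic\<close>

text \<open>
  The notions of this section are meant for finite distributive lattices, given as
  order records in the sense of HOL-Algebra whose equality is HOL equality.
\<close>

definition join_irreducible :: "('a, 'b) gorder_scheme \<Rightarrow> 'a \<Rightarrow> bool" where
  "join_irreducible L a \<longleftrightarrow> a \<in> carrier L \<and> a \<noteq> \<bottom>\<^bsub>L\<^esub> \<and>
     (\<forall>b\<in>carrier L. \<forall>c\<in>carrier L. a = b \<squnion>\<^bsub>L\<^esub> c \<longrightarrow> a \<in> {b, c})"

definition valuation :: "('a, 'b) gorder_scheme \<Rightarrow> ('a \<Rightarrow> 'r::comm_ring_1) \<Rightarrow> bool" where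
  "valuation L \<nu> \<longleftrightarrow> \<nu> \<bottom>\<^bsub>L\<^esub> = 0 \<and>
     (\<forall>x\<in>carrier L. \<forall>y\<in>carrier L. \<nu> x + \<nu> y = \<nu> (x \<sqinter>\<^bsub>L\<^esub> y) + \<nu> (x \<squnion>\<^bsub>L\<^esub> y))"

text \<open>
  A valuation is determined by its values on join-irreducibles only as a function on the
  carrier; membership in \<^const>\<open>extensional\<close> fixes the irrelevant values elsewhere, so that the
  description is unique.
\<close>

definition euler_char :: "('a, 'b) gorder_scheme \<Rightarrow> 'a \<Rightarrow> 'r::comm_ring_1" where
  "euler_char L = (THE \<chi>. \<chi> \<in> extensional (carrier L) \<and> valuation L \<chi> \<and>
     (\<forall>a. join_irreducible L a \<longrightarrow> \<chi> a = 1))"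

section \<open>The middle order\<close>

text \<open>
  Permutations in \<open>S\<^sub>n\<close> are functions \<open>w\<close> with \<open>w permutes {1..n}\<close>; the one-line notation of \<open>w\<close>
  is \<open>w 1, \<dots>, w n\<close>, so \<open>inv w j\<close> is the position of the entry \<open>j\<close>.
\<close>

definition inversion_seq :: "(nat \<Rightarrow> nat) \<Rightarrow> nat \<Rightarrow> nat" where
  "inversion_seq w i = card {j \<in> {1..<i}. inv w j > inv w i}"

definition middle_order :: "nat \<Rightarrow> (nat \<Rightarrow> nat) gorder" where
  "middle_order n =
     \<lparr>carrier = {w. w permutes {1..n}},
      eq = (=),
      le = (\<lambda>v w. \<forall>i\<in>{1..n}. inversion_seq v i \<le> inversion_seq w i)\<rparr>"

definition right_to_left_minima :: "nat \<Rightarrow> (nat \<Rightarrow> nat) \<Rightarrow> nat set" where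
  "right_to_left_minima n w = {i \<in> {1..n}. \<not> (\<exists>j\<in>{1..n}. j < i \<and> inv w j > inv w i)}"

definition right_to_left_nonminima :: "nat \<Rightarrow> (nat \<Rightarrow> nat) \<Rightarrow> nat set" where
  "right_to_left_nonminima n w = {1..n} - right_to_left_minima n w"

section \<open>Permutations by number of cycles\<close>

text \<open>Fixed points count as cycles of length one.\<close>

definition num_cycles :: "nat \<Rightarrow> (nat \<Rightarrow> nat) \<Rightarrow> nat" where
  "num_cycles n w = card (orbit w ` {1..n})"

text \<open>
  The second argument is an integer, so that the number is \<open>0\<close> for negative arguments; truncated
  subtraction would give a wrong value of \<open>c(n, n - k)\<close> for \<open>n = 0\<close> and \<open>k > 0\<close>.
\<close>

definition perm_cycle_count :: "nat \<Rightarrow> int \<Rightarrow> nat" where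
  "perm_cycle_count n m = card {w. w permutes {1..n} \<and> int (num_cycles n w) = m}"

end

theory Submission
  imports Defs
begin

text \<open>
  Inversion sequences identify the middle order with the product of chains
  \<open>\<Prod>i\<in>{1..n}. {0, \<dots>, i - 1}\<close> under componentwise order. In a product of chains the
  join-irreducibles are the vectors with exactly one nonzero coordinate, and the number of nonzero
  coordinates is a valuation; so it is the Euler characteristic. A coordinate of the inversion
  sequence of \<open>w\<close> vanishes exactly at the right-to-left minima of \<open>w\<close>. Finally, zeros of
  inversion sequences and cycles of permutations obey the same recursion: passing from \<open>n\<close> to
  \<open>n + 1\<close>, one of the \<open>n + 1\<close> choices creates a new zero (a new fixed point), and each of the other
  \<open>n\<close> choices leaves the count unchanged.
\<close>

section \<open>Inversion sequences\<close>

lemma inversion_seq_less: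
  assumes "1 \<le> i"
  shows "inversion_seq w i < i"
proof -
  have "inversion_seq w i \<le> card {1..<i}"
    unfolding inversion_seq_def by (intro card_mono) auto
  then show ?thesis using assms by simp
qed

lemma inversion_seq_eq_0_iff:
  "inversion_seq w i = 0 \<longleftrightarrow> (\<forall>j\<in>{1..<i}. inv w j \<le> inv w i)"
  by (auto simp: inversion_seq_def not_less)

lemma right_to_left_minima_eq:
  "right_to_left_minima n w = {i \<in> {1..n}. inversion_seq w i = 0}"
  unfolding right_to_left_minima_def
proof (intro Collect_cong conj_cong refl)
  fix i assume "i \<in> {1..n}"
  then have *: "{1..<i} = {1..n} \<inter> {..<i}" by auto
  show "\<not> (\<exists>j\<in>{1..n}. j < i \<and> inv w i < inv w j) \<longleftrightarrow> inversion_seq w i = 0"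
    unfolding inversion_seq_eq_0_iff * not_less[symmetric] by blast
qed

lemma right_to_left_nonminima_eq:
  "right_to_left_nonminima n w = {i \<in> {1..n}. inversion_seq w i \<noteq> 0}"
  by (auto simp: right_to_left_nonminima_def right_to_left_minima_eq)

section \<open>Permutations recovered from their inversion sequences\<close>

text \<open>Insertion argument: once the order on the indices up to \<open>n\<close> is known, the
  last count says how many of them lie above index \<open>Suc n\<close>. In a finite chain the
  up-set of a given size is unique, so the place of the new index is forced.\<close>

lemma inversion_counts_determine_order:
  fixes p q :: "nat \<Rightarrow> 'a::linorder"
  assumes "inj_on p {1..n}" "inj_on q {1..n}"
    and "\<And>i. i \<in> {1..n} \<Longrightarrow> card {j \<in> {1..<i}. p i < p j} = card {j \<in> {1..<i}. q i < q j}"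
    and "i \<in> {1..n}" "j \<in> {1..n}"
  shows "p i < p j \<longleftrightarrow> q i < q j"
  using assms
proof (induction n arbitrary: i j)
  case (Suc n)
  have sub: "{1..n} \<subseteq> {1..Suc n}" by auto
  have IH: "p i < p j \<longleftrightarrow> q i < q j" if "i \<in> {1..n}" "j \<in> {1..n}" for i j
    using Suc.IH[OF inj_on_subset[OF Suc.prems(1) sub] inj_on_subset[OF Suc.prems(2) sub] _ that]
      Suc.prems(3) by simp
  define A where "A = {j \<in> {1..n}. p (Suc n) < p j}"
  define B where "B = {j \<in> {1..n}. q (Suc n) < q j}"
  have card: "card A = card B"
    using Suc.prems(3)[of "Suc n"] by (simp add: A_def B_def atLeastLessThanSuc_atLeastAtMost)
  \<comment> \<open>Both are up-sets of the common order on \<open>{1..n}\<close>, hence comparable.\<close>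
  have "A \<subseteq> B \<or> B \<subseteq> A"
  proof (rule ccontr)
    assume "\<not> (A \<subseteq> B \<or> B \<subseteq> A)"
    then obtain a b where ab: "a \<in> A" "a \<notin> B" "b \<in> B" "b \<notin> A" by blast
    then have "p b < p a" "\<not> q b < q a" by (auto simp: A_def B_def)
    moreover have "a \<in> {1..n}" "b \<in> {1..n}" using ab by (auto simp: A_def B_def)
    ultimately show False using IH by blast
  qed
  moreover have "finite A" "finite B" by (auto simp: A_def B_def)
  ultimately have AB: "A = B" using card by (metis card_subset_eq)
  have last: "p (Suc n) < p j \<longleftrightarrow> q (Suc n) < q j" if "j \<in> {1..n}" for j
    using AB that by (auto simp: A_def B_def)
  have neq: "p j \<noteq> p (Suc n)" "q j \<noteq> q (Suc n)" if "j \<in> {1..n}" for j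
    using that inj_onD[OF Suc.prems(1), of j "Suc n"] inj_onD[OF Suc.prems(2), of j "Suc n"] by auto
  have first: "p j < p (Suc n) \<longleftrightarrow> q j < q (Suc n)" if "j \<in> {1..n}" for j
    using last[OF that] neq[OF that] by (metis less_asym linorder_neqE)
  have "i = Suc n \<or> i \<in> {1..n}" "j = Suc n \<or> j \<in> {1..n}"
    using Suc.prems(4,5) by auto
  then show ?case using IH last first by auto
qed simp

text \<open>Since \<open>p\<close> is onto \<open>{1..n}\<close>, the value \<open>p i\<close> is
  the rank of \<open>i\<close>, that is, the number of \<open>j\<close> with \<open>p j\<close> at
  most \<open>p i\<close>; the order determines this number.\<close>

lemma permutes_eqI_order:
  assumes p: "p permutes {1..n::nat}" and q: "q permutes {1..n}"
    and ord: "\<And>i j. i \<in> {1..n} \<Longrightarrow> j \<in> {1..n} \<Longrightarrow> p i < p j \<longleftrightarrow> q i < q j"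
  shows "p = q"
proof
  have rank: "r i = card {j \<in> {1..n}. \<not> r i < r j}"
    if r: "r permutes {1..n}" and i: "i \<in> {1..n}" for r :: "nat \<Rightarrow> nat" and i
  proof -
    have "r i \<in> {1..n}" using permutes_in_image[OF r] i by blast
    have "r ` {j \<in> {1..n}. \<not> r i < r j} = {x \<in> r ` {1..n}. x \<le> r i}"
      by (auto simp: not_less)
    also have "\<dots> = {1..r i}"
      unfolding permutes_image[OF r] using \<open>r i \<in> {1..n}\<close> by auto
    finally show ?thesis
      using card_image[OF permutes_inj_on[OF r], of "{j \<in> {1..n}. \<not> r i < r j}"] by simp
  qed
  show "p i = q i" for i
  proof (cases "i \<in> {1..n}")
    case True
    then have "{j \<in> {1..n}. \<not> p i < p j} = {j \<in> {1..n}. \<not> q i < q j}" using ord by auto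
    then show ?thesis using rank[OF p True] rank[OF q True] by simp
  next
    case False
    then show ?thesis using p q by (simp add: permutes_not_in)
  qed
qed

lemma inversion_seq_inject:
  assumes v: "v permutes {1..n}" and w: "w permutes {1..n}"
    and eq: "\<And>i. i \<in> {1..n} \<Longrightarrow> inversion_seq v i = inversion_seq w i"
  shows "v = w"
proof -
  have v': "inv v permutes {1..n}" and w': "inv w permutes {1..n}"
    using v w by (auto intro: permutes_inv)
  \<comment> \<open>\<open>inversion_seq\<close> compares positions of entries, so the two order
    lemmas apply to the inverses.\<close>
  have "inv v = inv w"
    using v' w'
  proof (rule permutes_eqI_order)
    show "inv v i < inv v j \<longleftrightarrow> inv w i < inv w j" if "i \<in> {1..n}" "j \<in> {1..n}" for i j
      using permutes_inj_on[OF v'] permutes_inj_on[OF w'] eq[unfolded inversion_seq_def] that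
      by (rule inversion_counts_determine_order)
  qed
  then show ?thesis using permutes_inv_inv[OF v] permutes_inv_inv[OF w] by metis
qed

text \<open>Surjectivity comes from counting: the map is injective and both sides have
  \<open>fact n\<close> elements. The \<open>restrict\<close> is there because \<open>PiE\<close>
  consists of extensional functions.\<close>

lemma bij_betw_inversion_seq:
  "bij_betw (\<lambda>w. restrict (inversion_seq w) {1..n}) {w. w permutes {1..n}}
     (\<Pi>\<^sub>E i\<in>{1..n}. {..<i})"
proof -
  let ?I = "\<lambda>w. restrict (inversion_seq w) {1..n}"
  let ?S = "{w. w permutes {1..n}}"
  let ?T = "\<Pi>\<^sub>E i\<in>{1..n}. {..<i}"
  have inj: "inj_on ?I ?S"
    by (rule inj_onI) (metis (mono_tags, lifting) inversion_seq_inject mem_Collect_eq restrict_apply')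
  have "?I ` ?S \<subseteq> ?T" using inversion_seq_less by auto
  moreover have "card (?I ` ?S) = card ?T"
    unfolding card_image[OF inj] by (subst card_permutations[OF refl]) (simp_all add: card_PiE fact_prod)
  moreover have "finite ?T" by (intro finite_PiE) auto
  ultimately show ?thesis using inj by (simp add: bij_betw_def card_subset_eq)
qed

text \<open>Source of the witnesses below: a permutation is produced by prescribing its
  coordinates.\<close>

lemma inversion_seq_surject:
  assumes "\<And>i. i \<in> {1..n} \<Longrightarrow> f i < i"
  obtains w where "w permutes {1..n}" "\<And>i. i \<in> {1..n} \<Longrightarrow> inversion_seq w i = f i"
proof -
  have "restrict f {1..n} \<in> (\<Pi>\<^sub>E i\<in>{1..n}. {..<i})" using assms by auto
  then have "restrict f {1..n} \<in> (\<lambda>w. restrict (inversion_seq w) {1..n}) ` {w. w permutes {1..n}}"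
    by (simp only: bij_betw_imp_surj_on[OF bij_betw_inversion_seq])
  then obtain w where "w permutes {1..n}" "restrict f {1..n} = restrict (inversion_seq w) {1..n}"
    by blast
  then show thesis using that by (metis restrict_apply')
qed

section \<open>The Euler characteristic of the middle order\<close>

lemma carrier_middle_order [simp]: "carrier (middle_order n) = {w. w permutes {1..n}}"
  and le_middle_order [simp]:
    "v \<sqsubseteq>\<^bsub>middle_order n\<^esub> w \<longleftrightarrow> (\<forall>i\<in>{1..n}. inversion_seq v i \<le> inversion_seq w i)"
  by (simp_all add: middle_order_def)

text \<open>Bottom, join and meet are Hilbert choices of a least or greatest element. Antisymmetry
  makes each choice equal to any candidate exhibited by its coordinates, as in the next three
  lemmas.\<close>

lemma middle_order_antisym:
  assumes "v permutes {1..n}" "w permutes {1..n}"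
    "v \<sqsubseteq>\<^bsub>middle_order n\<^esub> w" "w \<sqsubseteq>\<^bsub>middle_order n\<^esub> v"
  shows "v = w"
  using assms by (intro inversion_seq_inject[of v n w]) (auto intro: antisym)

lemma bottom_middle_order_eqI:
  assumes "w permutes {1..n}" "\<And>i. i \<in> {1..n} \<Longrightarrow> inversion_seq w i = 0"
  shows "\<bottom>\<^bsub>middle_order n\<^esub> = w"
  unfolding bottom_def
proof (rule some_equality)
  show least: "least (middle_order n) w (carrier (middle_order n))"
    using assms by (simp add: least_def)
  show "v = w" if "least (middle_order n) v (carrier (middle_order n))" for v
    using that least by (intro middle_order_antisym[of v n w]) (auto simp: least_def)
qed

lemma join_middle_order_eqI:
  assumes "u permutes {1..n}" "v permutes {1..n}" "w permutes {1..n}"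
    and "\<And>i. i \<in> {1..n} \<Longrightarrow> inversion_seq w i = max (inversion_seq u i) (inversion_seq v i)"
  shows "u \<squnion>\<^bsub>middle_order n\<^esub> v = w"
  unfolding join_def sup_def
proof (rule some_equality)
  let ?U = "Upper (middle_order n) {u, v}"
  show least: "least (middle_order n) w ?U"
    using assms by (auto simp: least_def Upper_def)
  show "w' = w" if "least (middle_order n) w' ?U" for w'
    using that least by (intro middle_order_antisym[of w' n w]) (auto simp: least_def)
qed

lemma meet_middle_order_eqI:
  assumes "u permutes {1..n}" "v permutes {1..n}" "w permutes {1..n}"
    and "\<And>i. i \<in> {1..n} \<Longrightarrow> inversion_seq w i = min (inversion_seq u i) (inversion_seq v i)"
  shows "u \<sqinter>\<^bsub>middle_order n\<^esub> v = w"
  unfolding meet_def inf_def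
proof (rule some_equality)
  let ?U = "Lower (middle_order n) {u, v}"
  show greatest: "greatest (middle_order n) w ?U"
    using assms by (auto simp: greatest_def Lower_def)
  show "w' = w" if "greatest (middle_order n) w' ?U" for w'
    using that greatest by (intro middle_order_antisym[of w' n w]) (auto simp: greatest_def)
qed

lemma bottom_middle_order:
  shows "\<bottom>\<^bsub>middle_order n\<^esub> permutes {1..n}"
    and "i \<in> {1..n} \<Longrightarrow> inversion_seq \<bottom>\<^bsub>middle_order n\<^esub> i = 0"
proof -
  obtain w where w: "w permutes {1..n}" "\<And>i. i \<in> {1..n} \<Longrightarrow> inversion_seq w i = 0"
    using inversion_seq_surject[of n "\<lambda>_. 0"] by auto
  then have "\<bottom>\<^bsub>middle_order n\<^esub> = w" by (rule bottom_middle_order_eqI)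
  with w show "\<bottom>\<^bsub>middle_order n\<^esub> permutes {1..n}"
    and "i \<in> {1..n} \<Longrightarrow> inversion_seq \<bottom>\<^bsub>middle_order n\<^esub> i = 0" by auto
qed

lemma join_middle_order:
  assumes "u permutes {1..n}" "v permutes {1..n}"
  shows "u \<squnion>\<^bsub>middle_order n\<^esub> v permutes {1..n}"
    and "i \<in> {1..n} \<Longrightarrow>
      inversion_seq (u \<squnion>\<^bsub>middle_order n\<^esub> v) i = max (inversion_seq u i) (inversion_seq v i)"
proof -
  obtain w where w: "w permutes {1..n}"
    "\<And>i. i \<in> {1..n} \<Longrightarrow> inversion_seq w i = max (inversion_seq u i) (inversion_seq v i)"
    by (rule inversion_seq_surject[of n "\<lambda>i. max (inversion_seq u i) (inversion_seq v i)"])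
      (auto intro: inversion_seq_less)
  with assms have "u \<squnion>\<^bsub>middle_order n\<^esub> v = w" by (intro join_middle_order_eqI)
  with w show "u \<squnion>\<^bsub>middle_order n\<^esub> v permutes {1..n}"
    and "i \<in> {1..n} \<Longrightarrow>
      inversion_seq (u \<squnion>\<^bsub>middle_order n\<^esub> v) i = max (inversion_seq u i) (inversion_seq v i)" by auto
qed

lemma meet_middle_order:
  assumes "u permutes {1..n}" "v permutes {1..n}"
  shows "u \<sqinter>\<^bsub>middle_order n\<^esub> v permutes {1..n}"
    and "i \<in> {1..n} \<Longrightarrow>
      inversion_seq (u \<sqinter>\<^bsub>middle_order n\<^esub> v) i = min (inversion_seq u i) (inversion_seq v i)"
proof -
  obtain w where w: "w permutes {1..n}"
    "\<And>i. i \<in> {1..n} \<Longrightarrow> inversion_seq w i = min (inversion_seq u i) (inversion_seq v i)"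
    by (rule inversion_seq_surject[of n "\<lambda>i. min (inversion_seq u i) (inversion_seq v i)"])
      (auto simp: min_less_iff_disj intro: inversion_seq_less)
  with assms have "u \<sqinter>\<^bsub>middle_order n\<^esub> v = w" by (intro meet_middle_order_eqI)
  with w show "u \<sqinter>\<^bsub>middle_order n\<^esub> v permutes {1..n}"
    and "i \<in> {1..n} \<Longrightarrow>
      inversion_seq (u \<sqinter>\<^bsub>middle_order n\<^esub> v) i = min (inversion_seq u i) (inversion_seq v i)" by auto
qed

section \<open>Supports of coordinate vectors and the join-irreducibles\<close>

lemma finite_right_to_left_nonminima [simp]: "finite (right_to_left_nonminima n w)"
  by (simp add: right_to_left_nonminima_def)

lemma eq_bottom_middle_order_iff:
  assumes "w permutes {1..n}"
  shows "w = \<bottom>\<^bsub>middle_order n\<^esub> \<longleftrightarrow> right_to_left_nonminima n w = {}"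
proof
  assume "right_to_left_nonminima n w = {}"
  then show "w = \<bottom>\<^bsub>middle_order n\<^esub>"
    using assms by (intro bottom_middle_order_eqI[symmetric]) (auto simp: right_to_left_nonminima_eq)
qed (auto simp: right_to_left_nonminima_eq bottom_middle_order)

text \<open>Erase coordinate \<open>i\<close> of \<open>w\<close> to get \<open>b\<close>, and keep
  only that coordinate to get \<open>c\<close>. Their supports are disjoint, so the meet is bottom.
  This serves both to recognise the join-irreducibles and to compute a valuation
  inductively.\<close>

lemma middle_order_split:
  assumes w: "w permutes {1..n}" and i: "i \<in> right_to_left_nonminima n w"
  obtains b c where "b permutes {1..n}" "c permutes {1..n}"
    "w = b \<squnion>\<^bsub>middle_order n\<^esub> c" "b \<sqinter>\<^bsub>middle_order n\<^esub> c = \<bottom>\<^bsub>middle_order n\<^esub>"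
    "right_to_left_nonminima n b = right_to_left_nonminima n w - {i}"
    "right_to_left_nonminima n c = {i}"
proof -
  obtain b where b: "b permutes {1..n}"
    "\<And>j. j \<in> {1..n} \<Longrightarrow> inversion_seq b j = (if j = i then 0 else inversion_seq w j)"
    by (rule inversion_seq_surject[of n "\<lambda>j. if j = i then 0 else inversion_seq w j"])
      (auto intro: inversion_seq_less)
  obtain c where c: "c permutes {1..n}"
    "\<And>j. j \<in> {1..n} \<Longrightarrow> inversion_seq c j = (if j = i then inversion_seq w j else 0)"
    by (rule inversion_seq_surject[of n "\<lambda>j. if j = i then inversion_seq w j else 0"])
      (auto intro: inversion_seq_less)
  show thesis
  proof
    show "w = b \<squnion>\<^bsub>middle_order n\<^esub> c"
      using b c w by (intro join_middle_order_eqI[symmetric]) auto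
    show "b \<sqinter>\<^bsub>middle_order n\<^esub> c = \<bottom>\<^bsub>middle_order n\<^esub>"
      using b c by (intro meet_middle_order_eqI bottom_middle_order(1)) (auto simp: bottom_middle_order(2))
    show "right_to_left_nonminima n b = right_to_left_nonminima n w - {i}"
      using b by (auto simp: right_to_left_nonminima_eq split: if_splits)
    show "right_to_left_nonminima n c = {i}"
      using c i by (auto simp: right_to_left_nonminima_eq split: if_splits)
  qed (use b c in auto)
qed

text \<open>If \<open>w\<close> is irreducible, splitting off a support element \<open>i\<close>
  forces \<open>w = c\<close>, because \<open>b\<close> has lost \<open>i\<close>. Conversely,
  elements supported on a single coordinate behave like a chain, where a maximum is one of its two
  arguments.\<close>

lemma join_irreducible_middle_order_iff:
  "join_irreducible (middle_order n) w \<longleftrightarrow>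
     w permutes {1..n} \<and> card (right_to_left_nonminima n w) = 1"
proof (intro iffI conjI; (elim conjE)?)
  assume irr: "join_irreducible (middle_order n) w"
  then show w: "w permutes {1..n}" by (simp add: join_irreducible_def)
  from irr have "right_to_left_nonminima n w \<noteq> {}"
    using eq_bottom_middle_order_iff[OF w] by (simp add: join_irreducible_def)
  then obtain i where i: "i \<in> right_to_left_nonminima n w" by blast
  obtain b c where bc: "b permutes {1..n}" "c permutes {1..n}" "w = b \<squnion>\<^bsub>middle_order n\<^esub> c"
    "right_to_left_nonminima n b = right_to_left_nonminima n w - {i}"
    "right_to_left_nonminima n c = {i}"
    using middle_order_split[OF w i] by metis
  then have "w \<in> {b, c}"
    using irr unfolding join_irreducible_def carrier_middle_order by blast
  moreover have "w \<noteq> b" using bc(4) i by blast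
  ultimately have "w = c" by blast
  then show "card (right_to_left_nonminima n w) = 1" using bc(5) by simp
next
  assume w: "w permutes {1..n}" and "card (right_to_left_nonminima n w) = 1"
  then obtain i where i: "right_to_left_nonminima n w = {i}" by (auto simp: card_1_singleton_iff)
  have zero: "inversion_seq w j = 0" if "j \<in> {1..n}" "j \<noteq> i" for j
  proof -
    have "j \<notin> right_to_left_nonminima n w" using i that by simp
    then show ?thesis using that by (simp add: right_to_left_nonminima_eq)
  qed
  have "w \<in> {b, c}"
    if b: "b permutes {1..n}" and c: "c permutes {1..n}" and bc: "w = b \<squnion>\<^bsub>middle_order n\<^esub> c" for b c
  proof -
    have max: "inversion_seq w j = max (inversion_seq b j) (inversion_seq c j)"
      if "j \<in> {1..n}" for j
      using that bc join_middle_order(2)[OF b c] by simp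
    \<comment> \<open>A maximum of naturals that is zero has both arguments zero, so
      \<open>b\<close> and \<open>c\<close> can differ only at \<open>i\<close>.\<close>
    have other: "inversion_seq b j = 0" "inversion_seq c j = 0" if "j \<in> {1..n}" "j \<noteq> i" for j
      using max[OF that(1)] zero[OF that] by simp_all
    show ?thesis
    proof (cases "inversion_seq c i \<le> inversion_seq b i")
      case True
      then have "inversion_seq w j = inversion_seq b j" if "j \<in> {1..n}" for j
        using max[OF that] zero[OF that] other[OF that] by (cases "j = i") auto
      then show ?thesis using inversion_seq_inject[OF w b] by blast
    next
      case False
      then have "inversion_seq w j = inversion_seq c j" if "j \<in> {1..n}" for j
        using max[OF that] zero[OF that] other[OF that] by (cases "j = i") auto
      then show ?thesis using inversion_seq_inject[OF w c] by blast
    qed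
  qed
  moreover have "w \<noteq> \<bottom>\<^bsub>middle_order n\<^esub>" using eq_bottom_middle_order_iff[OF w] i by simp
  ultimately show "join_irreducible (middle_order n) w"
    using w by (auto simp: join_irreducible_def)
qed

section \<open>Existence and uniqueness of the Euler characteristic\<close>

text \<open>Join and meet act on supports as union and intersection, so the identity is
  inclusion-exclusion for \<open>card\<close>. Values of \<chi> off the carrier are left free, so
  that an extensional function can be plugged in later.\<close>

lemma valuation_middle_order_card_nonminima:
  assumes "\<And>w. w permutes {1..n} \<Longrightarrow> \<chi> w = of_nat (card (right_to_left_nonminima n w))"
  shows "valuation (middle_order n) \<chi>"
  unfolding valuation_def
proof (intro conjI ballI)
  show "\<chi> \<bottom>\<^bsub>middle_order n\<^esub> = 0"
    using eq_bottom_middle_order_iff[OF bottom_middle_order(1)] assms[OF bottom_middle_order(1)]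
    by simp
  fix u v assume "u \<in> carrier (middle_order n)" "v \<in> carrier (middle_order n)"
  then have u: "u permutes {1..n}" and v: "v permutes {1..n}" by auto
  let ?N = "right_to_left_nonminima n"
  have "?N (u \<squnion>\<^bsub>middle_order n\<^esub> v) = ?N u \<union> ?N v" "?N (u \<sqinter>\<^bsub>middle_order n\<^esub> v) = ?N u \<inter> ?N v"
    using join_middle_order(2)[OF u v] meet_middle_order(2)[OF u v]
    by (auto simp: right_to_left_nonminima_eq max_def min_def split: if_splits)
  moreover have "card (?N u) + card (?N v) = card (?N u \<inter> ?N v) + card (?N u \<union> ?N v)"
    using card_Un_Int[of "?N u" "?N v"] by simp
  ultimately show "\<chi> u + \<chi> v = \<chi> (u \<sqinter>\<^bsub>middle_order n\<^esub> v) + \<chi> (u \<squnion>\<^bsub>middle_order n\<^esub> v)"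
    unfolding assms[OF u] assms[OF v] assms[OF join_middle_order(1)[OF u v]]
      assms[OF meet_middle_order(1)[OF u v]]
    by (simp flip: of_nat_add)
qed

text \<open>Induction on the size of the support: splitting off one coordinate removes a
  join-irreducible \<open>c\<close>, which contributes 1.\<close>

lemma valuation_middle_order_unique:
  assumes val: "valuation (middle_order n) \<nu>"
    and irr: "\<And>a. join_irreducible (middle_order n) a \<Longrightarrow> \<nu> a = 1"
    and w: "w permutes {1..n}"
  shows "\<nu> w = of_nat (card (right_to_left_nonminima n w))"
  using w
proof (induction "card (right_to_left_nonminima n w)" arbitrary: w)
  case 0
  then have "w = \<bottom>\<^bsub>middle_order n\<^esub>" using eq_bottom_middle_order_iff[of w n] by simp
  then show ?case using val 0 by (simp add: valuation_def)
next
  case (Suc k)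
  then obtain i where i: "i \<in> right_to_left_nonminima n w" by fastforce
  obtain b c where bc: "b permutes {1..n}" "c permutes {1..n}" "w = b \<squnion>\<^bsub>middle_order n\<^esub> c"
    "b \<sqinter>\<^bsub>middle_order n\<^esub> c = \<bottom>\<^bsub>middle_order n\<^esub>"
    "right_to_left_nonminima n b = right_to_left_nonminima n w - {i}"
    "right_to_left_nonminima n c = {i}"
    using middle_order_split[OF Suc.prems i] by metis
  have "\<nu> c = 1" using bc by (intro irr) (simp add: join_irreducible_middle_order_iff)
  moreover have k: "k = card (right_to_left_nonminima n b)" using bc(5) i Suc.hyps(2) by simp
  then have "\<nu> b = of_nat k" using Suc.hyps(1)[OF k bc(1)] by simp
  \<comment> \<open>As the meet of \<open>b\<close> and \<open>c\<close> is bottom, where a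
    valuation vanishes, the modular identity becomes additivity.\<close>
  moreover have "\<nu> b + \<nu> c = \<nu> \<bottom>\<^bsub>middle_order n\<^esub> + \<nu> w"
    unfolding bc(3) bc(4)[symmetric] using val bc(1,2) by (simp add: valuation_def)
  then have "\<nu> b + \<nu> c = \<nu> w" using val by (simp add: valuation_def)
  ultimately show ?case using Suc.hyps(2) by (metis add.commute of_nat_Suc)
qed

theorem euler_char_middle_order:
  assumes "w permutes {1..n}"
  shows "euler_char (middle_order n) w = of_nat (card (right_to_left_nonminima n w))"
proof -
  \<comment> \<open>Restricted to the carrier, because \<open>euler_char\<close> selects an
    extensional function.\<close>
  define \<chi> :: "(nat \<Rightarrow> nat) \<Rightarrow> 'a" where
    "\<chi> = (\<lambda>w\<in>{w. w permutes {1..n}}. of_nat (card (right_to_left_nonminima n w)))"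
  have "euler_char (middle_order n) = \<chi>"
    unfolding euler_char_def
  proof (rule the_equality, intro conjI allI impI)
    show "\<chi> \<in> extensional (carrier (middle_order n))" by (simp add: \<chi>_def)
    show "valuation (middle_order n) \<chi>"
      by (rule valuation_middle_order_card_nonminima) (simp add: \<chi>_def)
    show "\<chi> a = 1" if "join_irreducible (middle_order n) a" for a
      using that by (simp add: join_irreducible_middle_order_iff \<chi>_def)
    show "\<nu> = \<chi>" if "\<nu> \<in> extensional (carrier (middle_order n)) \<and> valuation (middle_order n) \<nu> \<and>
      (\<forall>a. join_irreducible (middle_order n) a \<longrightarrow> \<nu> a = 1)" for \<nu>
    proof (rule extensionalityI)
      show "\<nu> \<in> extensional {w. w permutes {1..n}}" "\<chi> \<in> extensional {w. w permutes {1..n}}"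
        using that by (simp_all add: \<chi>_def)
      show "\<nu> w = \<chi> w" if "w \<in> {w. w permutes {1..n}}" for w
        using that valuation_middle_order_unique[of n \<nu> w]
          \<open>_ \<and> valuation (middle_order n) \<nu> \<and> _\<close> by (simp add: \<chi>_def)
    qed
  qed
  then show ?thesis using assms by (simp add: \<chi>_def)
qed

section \<open>Zeros of inversion sequences and cycles of permutations\<close>

text \<open>As \<open>p\<close> fixes \<open>a\<close>, composing with the transposition inserts
  \<open>a\<close> into the cycle of \<open>b\<close> just before \<open>b\<close>: the old
  predecessor of \<open>b\<close> now goes to \<open>a\<close>, and \<open>a\<close> goes to
  \<open>b\<close>. Within \<open>S\<close> the cycles keep their points.\<close>

lemma orbit_transpose_comp:
  assumes p: "p permutes S" and a: "a \<notin> S" and b: "b \<in> S" and x: "x \<in> S"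
  shows "orbit (transpose a b \<circ> p) x \<inter> S = orbit p x"
proof -
  define w where "w = transpose a b \<circ> p"
  have pS: "p y \<in> S \<longleftrightarrow> y \<in> S" for y using permutes_in_image[OF p] .
  have pa: "p a = a" using p a by (simp add: permutes_not_in)
  have wa: "w a = b" by (simp add: w_def pa)
  have wS: "w y = (if p y = b then a else p y)" if "y \<in> S" for y
  proof -
    have "p y \<noteq> a" using that a pS by blast
    then show ?thesis by (simp add: w_def transpose_def)
  qed
  \<comment> \<open>Each step of \<open>p\<close> is one step of \<open>w\<close>, or two steps with
    a detour through \<open>a\<close> when it lands on \<open>b\<close>.\<close>
  have sup: "y \<in> orbit w x \<inter> S" if "y \<in> orbit p x" for y
    using that
  proof induction
    case base
    show ?case
    proof (cases "p x = b")
      case True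
      then have "a \<in> orbit w x" using wS[OF x] orbit.base[of w x] by simp
      then have "w a \<in> orbit w x" by (rule orbit.step)
      then show ?thesis unfolding wa using True b by simp
    next
      case False
      then show ?thesis using wS[OF x] orbit.base[of w x] x pS by simp
    qed
  next
    case (step y)
    then have y: "y \<in> S" "y \<in> orbit w x" by auto
    show ?case
    proof (cases "p y = b")
      case True
      then have "a \<in> orbit w x" using wS[OF y(1)] orbit.step[OF y(2)] by simp
      then have "w a \<in> orbit w x" by (rule orbit.step)
      then show ?thesis unfolding wa using True b by simp
    next
      case False
      then show ?thesis using wS[OF y(1)] orbit.step[OF y(2)] y pS by simp
    qed
  qed
  \<comment> \<open>The second conjunct strengthens the induction: on leaving \<open>S\<close> the
    path is at \<open>a\<close>, and the next step returns to \<open>b\<close>, which must already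
    be in the orbit of \<open>p\<close>.\<close>
  have sub: "(z \<in> S \<longrightarrow> z \<in> orbit p x) \<and> (z \<notin> S \<longrightarrow> z = a \<and> b \<in> orbit p x)"
    if "z \<in> orbit w x" for z
    using that
  proof induction
    case base
    show ?case using wS[OF x] orbit.base[of p x] x pS a b by auto
  next
    case (step z)
    show ?case
    proof (cases "z \<in> S")
      case True
      then have "p z \<in> orbit p x" using step.IH by (auto intro: orbit.step)
      then show ?thesis using wS[OF True] True pS a b by auto
    next
      case False
      then have "z = a" "b \<in> orbit p x" using step.IH by auto
      then show ?thesis using wa b by auto
    qed
  qed
  show ?thesis unfolding w_def[symmetric] using sup sub by blast
qed

text \<open>The point \<open>a\<close> shares the orbit of \<open>b\<close>, so it adds no orbit of
  its own. Intersecting with \<open>S\<close> then matches the remaining orbits with those of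
  \<open>p\<close>.\<close>

lemma card_orbits_transpose_comp:
  assumes S: "finite S" and p: "p permutes S" and a: "a \<notin> S" and b: "b \<in> S"
  shows "card (orbit (transpose a b \<circ> p) ` insert a S) = card (orbit p ` S)"
proof -
  let ?w = "transpose a b \<circ> p"
  have w: "?w permutes insert a S"
    using p b by (intro permutes_compose[OF permutes_subset[OF p]] permutes_swap_id) auto
  then have perm: "permutation ?w" using S by (auto simp: permutation_permutes)
  have "?w a = b" using p a by (simp add: permutes_not_in)
  then have "orbit ?w b = orbit ?w a" using permutation_orbit_step[OF perm, of a] by simp
  then have "orbit ?w ` insert a S = orbit ?w ` S" using b by auto
  then have "card (orbit ?w ` insert a S) = card (orbit ?w ` S)" by (rule arg_cong)
  also have "\<dots> = card ((\<lambda>A. A \<inter> S) ` orbit ?w ` S)"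
  \<comment> \<open>Injectivity: \<open>x\<close> lies in its own orbit and in \<open>S\<close>,
    hence in the orbit of \<open>y\<close>, and two orbits of a permutation sharing a point
    coincide.\<close>
  proof (rule card_image[symmetric], rule inj_onI, clarify)
    fix x y assume xy: "x \<in> S" "y \<in> S" "orbit ?w x \<inter> S = orbit ?w y \<inter> S"
    then have "x \<in> orbit ?w y" using permutation_self_in_orbit[OF perm, of x] by blast
    then show "orbit ?w x = orbit ?w y"
      using orbit_cyclic_eq3 cyclic_on_orbit[OF w] S by (metis finite.insertI)
  qed
  also have "(\<lambda>A. A \<inter> S) ` orbit ?w ` S = orbit p ` S"
    unfolding image_image using orbit_transpose_comp[OF p a b] by (intro image_cong) auto
  finally show ?thesis .
qed

text \<open>For \<open>b = Suc n\<close> the transposition is the identity and \<open>Suc n\<close>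
  becomes a new fixed point; otherwise \<open>Suc n\<close> is inserted into an existing
  cycle.\<close>

lemma num_cycles_Suc:
  assumes p: "p permutes {1..n}" and b: "b \<in> {1..Suc n}"
  shows "num_cycles (Suc n) (transpose (Suc n) b \<circ> p) =
    (if b = Suc n then Suc (num_cycles n p) else num_cycles n p)"
proof (cases "b = Suc n")
  case True
  have "p (Suc n) = Suc n" using p by (simp add: permutes_not_in)
  then have "orbit p (Suc n) = {Suc n}" by (simp add: orbit_eq_singleton_iff)
  moreover have "Suc n \<notin> orbit p i" if "i \<in> {1..n}" for i
    using permutes_orbit_subset[OF p that] by auto
  ultimately have "orbit p (Suc n) \<notin> orbit p ` {1..n}" by (metis imageE singletonI)
  then show ?thesis using True by (simp add: num_cycles_def atLeastAtMostSuc_conv)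
next
  case False
  then show ?thesis
    using card_orbits_transpose_comp[OF _ p, of "Suc n" b] b
    by (simp add: num_cycles_def atLeastAtMostSuc_conv)
qed

section \<open>Equidistribution of zeros and cycles\<close>

text \<open>The weight \<open>g\<close> is arbitrary so that the induction hypothesis can be used
  for both \<open>g\<close> and its shift by \<open>Suc\<close>. Either side at \<open>Suc n\<close>
  is its value at \<open>n\<close> for the shifted weight plus \<open>n\<close> times its value for
  \<open>g\<close>.\<close>

lemma sum_zeros_eq_sum_num_cycles:
  fixes g :: "nat \<Rightarrow> nat"
  shows "(\<Sum>f\<in>(\<Pi>\<^sub>E i\<in>{1..n}. {..<i}). g (card {i \<in> {1..n}. f i = 0})) =
    (\<Sum>w | w permutes {1..n}. g (num_cycles n w))"
proof (induction n arbitrary: g)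
  case 0
  have "{w. w permutes {1..0::nat}} = {id}" by auto
  then show ?case by (simp add: num_cycles_def)
next
  case (Suc n)
  let ?T = "\<Pi>\<^sub>E i\<in>{1..n}. {..<i}" and ?S = "{w. w permutes {1..n}}"
  let ?z = "\<lambda>n f. card {i \<in> {1..n}. f i = (0::nat)}"
  have notin: "Suc n \<notin> {1..n}" by simp
  have ins: "{1..Suc n} = insert (Suc n) {1..n}" by auto
  have z: "?z (Suc n) (f(Suc n := y)) = (if y = 0 then Suc (?z n f) else ?z n f)" for f y
  proof -
    have "{i \<in> {1..Suc n}. (f(Suc n := y)) i = 0} =
        (if y = 0 then insert (Suc n) {i \<in> {1..n}. f i = 0} else {i \<in> {1..n}. f i = 0})"
      by auto
    then show ?thesis by simp
  qed
  have "(\<Sum>f\<in>(\<Pi>\<^sub>E i\<in>{1..Suc n}. {..<i}). g (?z (Suc n) f)) =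
      (\<Sum>(y, f)\<in>{..<Suc n} \<times> ?T. g (?z (Suc n) (f(Suc n := y))))"
    unfolding ins PiE_insert_eq
    by (subst sum.reindex[OF inj_combinator[OF notin]]) (simp add: case_prod_unfold)
  also have "\<dots> = (\<Sum>y<Suc n. \<Sum>f\<in>?T. g (if y = 0 then Suc (?z n f) else ?z n f))"
    unfolding z by (simp add: sum.cartesian_product)
  \<comment> \<open>The term \<open>y = 0\<close> is the new zero; the other \<open>n\<close> values
    of \<open>y\<close> give equal terms.\<close>
  also have "\<dots> = (\<Sum>f\<in>?T. g (Suc (?z n f))) + n * (\<Sum>f\<in>?T. g (?z n f))"
    unfolding sum.lessThan_Suc_shift by simp
  also have "\<dots> = (\<Sum>w\<in>?S. g (Suc (num_cycles n w))) + n * (\<Sum>w\<in>?S. g (num_cycles n w))"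
    using Suc.IH[of "\<lambda>k. g (Suc k)"] Suc.IH[of g] by simp
  \<comment> \<open>The same recursion read backwards: \<open>b = Suc n\<close> gives the shifted
    sum, and each of the other \<open>n\<close> choices of \<open>b\<close> gives the unshifted
    one.\<close>
  also have "\<dots> = (\<Sum>b\<in>insert (Suc n) {1..n}. \<Sum>w\<in>?S.
      g (if b = Suc n then Suc (num_cycles n w) else num_cycles n w))"
    by simp
  also have "\<dots> = (\<Sum>b\<in>insert (Suc n) {1..n}. \<Sum>w\<in>?S.
      g (num_cycles (Suc n) (transpose (Suc n) b \<circ> w)))"
    by (intro sum.cong refl arg_cong[where f = g] num_cycles_Suc[symmetric]) auto
  also have "\<dots> = (\<Sum>w | w permutes {1..Suc n}. g (num_cycles (Suc n) w))"
    unfolding ins by (rule sum_over_permutations_insert[symmetric]) auto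
  finally show ?case .
qed

text \<open>The weighted identity for the indicator of \<open>P\<close>, carried from vectors to
  permutations along the inversion sequence bijection.\<close>

lemma card_minima_eq_card_num_cycles:
  "card {w. w permutes {1..n} \<and> P (card (right_to_left_minima n w))} =
   card {w. w permutes {1..n} \<and> P (num_cycles n w)}"
proof -
  let ?S = "{w. w permutes {1..n}}"
  let ?g = "\<lambda>k. if P k then 1 else 0 :: nat"
  have fin: "finite ?S" by (simp add: finite_permutations)
  have count: "card {w. w permutes {1..n} \<and> Q w} = (\<Sum>w\<in>?S. if Q w then 1 else 0)" for Q
    using sum.inter_filter[OF fin, of "\<lambda>_. 1::nat" Q] by simp
  have "(\<Sum>w\<in>?S. ?g (card (right_to_left_minima n w))) =
      (\<Sum>w\<in>?S. ?g (card {i \<in> {1..n}. restrict (inversion_seq w) {1..n} i = 0}))"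
    unfolding right_to_left_minima_eq
    by (intro sum.cong refl arg_cong[where f = ?g] arg_cong[where f = card]) auto
  also have "\<dots> = (\<Sum>f\<in>(\<Pi>\<^sub>E i\<in>{1..n}. {..<i}). ?g (card {i \<in> {1..n}. f i = 0}))"
    by (rule sum.reindex_bij_betw[OF bij_betw_inversion_seq])
  also have "\<dots> = (\<Sum>w\<in>?S. ?g (num_cycles n w))" by (rule sum_zeros_eq_sum_num_cycles)
  finally show ?thesis unfolding count .
qed

lemma card_right_to_left_nonminima:
  "int (card (right_to_left_nonminima n w)) = int n - int (card (right_to_left_minima n w))"
proof -
  have sub: "right_to_left_minima n w \<subseteq> {1..n}" by (auto simp: right_to_left_minima_def)
  then show ?thesis
    using card_mono[OF _ sub] by (simp add: right_to_left_nonminima_def card_Diff_subset finite_subset)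
qed

theorem theorem4p4:
  fixes n :: nat
  shows "(\<forall>w. w permutes {1..n} \<longrightarrow>
            (euler_char (middle_order n) w :: 'r::comm_ring_1)
              = of_nat (card (right_to_left_nonminima n w)))
       \<and> (\<forall>k::int.
            card {w. w permutes {1..n} \<and>
                     (euler_char (middle_order n) w :: 's::{comm_ring_1,ring_char_0}) = of_int k}
              = perm_cycle_count n (int n - k))"
proof (intro conjI allI impI)
  show "(euler_char (middle_order n) w :: 'r) = of_nat (card (right_to_left_nonminima n w))"
    if "w permutes {1..n}" for w
    using that by (rule euler_char_middle_order)
  fix k :: int
  have "(euler_char (middle_order n) w :: 's) = of_int k \<longleftrightarrow>
      int (card (right_to_left_minima n w)) = int n - k" if "w permutes {1..n}" for w
  proof -
    \<comment> \<open>Rewritten through \<open>of_int\<close> so that its injectivity applies; this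
      is where characteristic zero enters, whereas the first claim holds over any commutative
      ring.\<close>
    have "(euler_char (middle_order n) w :: 's) = of_int (int (card (right_to_left_nonminima n w)))"
      by (simp add: euler_char_middle_order[OF that])
    then have "(euler_char (middle_order n) w :: 's) = of_int k \<longleftrightarrow>
        int (card (right_to_left_nonminima n w)) = k"
      by (simp only: of_int_eq_iff)
    then show ?thesis unfolding card_right_to_left_nonminima by linarith
  qed
  then have "{w. w permutes {1..n} \<and> (euler_char (middle_order n) w :: 's) = of_int k} =
      {w. w permutes {1..n} \<and> int (card (right_to_left_minima n w)) = int n - k}"
    by blast
  then show "card {w. w permutes {1..n} \<and> (euler_char (middle_order n) w :: 's) = of_int k} =
      perm_cycle_count n (int n - k)"
    using card_minima_eq_card_num_cycles[of n "\<lambda>m. int m = int n - k"]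
    by (simp add: perm_cycle_count_def)
qed

end
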